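(* For every bipartite graph $G$ and every integer $r\geq 2$, $$\mathrm{box}(M_r(G))\leq \mathrm{box}(M_2(G))+2,$$ where $M_r(G)$ denotes the generalized Mycielski graph of $G$.
   Context: All graphs are finite, simple and undirected. Boxicity: a box in Euclidean $k$-space is a Cartesian product $I_1\times\cdots\times I_k$ where each $I_j$ is a closed interval on the real line. The boxicity $\mathrm{box}(G)$ is the minimum nonnegative integer $k$ such that $G$ can be represented as the intersection graph of a family of boxes $(B_v)_{v\in V(G)}$ in Euclidean $k$-space, i.e. for distinct vertices $u,v$, $uv\in E(G)$ if and only if $B_u\cap B_v\neq\emptyset$. The boxicity of a complete graph is defined to be $0$. Generalized Mycielski graph: let $r\geq 2$ be an integer, let $V(G)_1,\ldots,V(G)_r$ be disjoint copies of $V(G)$, where $v_i\in V(G)_i$ denotes the copy of $v\in V(G)$, and let $z$ be a new vertex. $M_r(G)$ has vertex set $\{z\}\cup\bigcup_{i=1}^r V(G)_i$ (disjoint union) and edge set $\bigcup_{i=1}^{r+1}E_i$, where $E_1=\{u_1v_1\mid uv\in E(G)\}$, $E_i=\{u_{i-1}v_i,\, v_{i-1}u_i\mid uv\in E(G)\}$ for $i=2,3,\ldots,r$, and $E_{r+1}=\{zu_r\mid u\in V(G)\}$. ($M_2(G)$ is the usual Mycielski graph $M(G)$.) *)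

theory Defs
  imports Complex_Main "HOL-Library.FuncSet" "Graph_Theory.Pair_Digraph"
begin

text \<open>
  Finite simple undirected graphs are the \<^locale>\<open>pair_graph\<close>s of Graph_Theory: finite, loop-free,
  symmetric digraphs whose arcs are pairs, an undirected edge \<open>uv\<close> being the two arcs \<open>(u, v)\<close> and
  \<open>(v, u)\<close>. The vertex set may be empty.
\<close>

definition bipartite :: "'a pair_pre_digraph \<Rightarrow> bool" where
  "bipartite G \<longleftrightarrow> (\<exists>X Y. pverts G = X \<union> Y \<and> X \<inter> Y = {} \<and> parcs G \<subseteq> X \<times> Y \<union> Y \<times> X)"

text \<open>
  A point of Euclidean \<open>k\<close>-space is an extensional function on \<open>{..<k}\<close>. Intervals are nonempty and
  bounded, possibly degenerate. For \<open>k = 0\<close> the only box is the one-point space itself, so exactly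
  the complete graphs are representable in dimension \<open>0\<close>.
\<close>

definition is_box :: "nat \<Rightarrow> (nat \<Rightarrow> real) set \<Rightarrow> bool" where
  "is_box k B \<longleftrightarrow>
    (\<exists>a b. (\<forall>j<k. a j \<le> b j) \<and> B = (\<Pi>\<^sub>E j\<in>{..<k}. {a j..b j}))"

definition box_representation ::
    "nat \<Rightarrow> 'a pair_pre_digraph \<Rightarrow> ('a \<Rightarrow> (nat \<Rightarrow> real) set) \<Rightarrow> bool" where
  "box_representation k G B \<longleftrightarrow>
    (\<forall>v\<in>pverts G. is_box k (B v)) \<and>
    (\<forall>u\<in>pverts G. \<forall>v\<in>pverts G. u \<noteq> v \<longrightarrow> ((u, v) \<in> parcs G \<longleftrightarrow> B u \<inter> B v \<noteq> {}))"

definition boxicity :: "'a pair_pre_digraph \<Rightarrow> nat" where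
  "boxicity G = (LEAST k. \<exists>B. box_representation k G B)"

text \<open>\<open>Copy i v\<close> is the copy \<open>v\<^sub>i\<close> of \<open>v\<close>, and \<open>Apex\<close> is the additional vertex \<open>z\<close>.\<close>

datatype 'a mycielski_vertex = Apex | Copy nat 'a

text \<open>
  \<open>mycielski_edges r G\<close> contains each undirected edge in at least one orientation. In the layers
  \<open>2 \<le> i \<le> r\<close>, one set comprehension yields both \<open>u\<^bsub>i-1\<^esub>v\<^sub>i\<close> and \<open>v\<^bsub>i-1\<^esub>u\<^sub>i\<close>, since \<open>parcs G\<close>
  contains both orientations of \<open>uv\<close>.
\<close>

definition mycielski_edges :: "nat \<Rightarrow> 'a pair_pre_digraph \<Rightarrow> 'a mycielski_vertex rel" where
  "mycielski_edges r G =
    {(Copy 1 u, Copy 1 v) | u v. (u, v) \<in> parcs G} \<union>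
    (\<Union>i\<in>{2..r}. {(Copy (i - 1) u, Copy i v) | u v. (u, v) \<in> parcs G}) \<union>
    {(Apex, Copy r u) | u. u \<in> pverts G}"

definition gen_mycielski ::
    "nat \<Rightarrow> 'a pair_pre_digraph \<Rightarrow> 'a mycielski_vertex pair_pre_digraph" where
  "gen_mycielski r G =
    \<lparr> pverts = {Apex} \<union> (\<Union>i\<in>{1..r}. Copy i ` pverts G),
      parcs = mycielski_edges r G \<union> (mycielski_edges r G)\<inverse> \<rparr>"

lemma pair_graph_gen_mycielski:
  assumes "pair_graph G" and "1 \<le> r"
  shows "pair_graph (gen_mycielski r G)"
proof -
  interpret pair_graph G by fact
  let ?M = "gen_mycielski r G"
  have E: "fst e \<in> pverts ?M \<and> snd e \<in> pverts ?M \<and> fst e \<noteq> snd e"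
    if "e \<in> mycielski_edges r G" for e
    using that assms(2) pair_no_loops
    by (fastforce simp: mycielski_edges_def gen_mycielski_def dest: in_arcsD1 in_arcsD2)
  then have E': "fst e \<in> pverts ?M \<and> snd e \<in> pverts ?M \<and> fst e \<noteq> snd e"
    if "e \<in> parcs ?M" for e
  proof -
    from that have "e \<in> mycielski_edges r G \<or> prod.swap e \<in> mycielski_edges r G"
      by (cases e) (auto simp: gen_mycielski_def)
    then show ?thesis
      using E[of e] E[of "prod.swap e"] by auto
  qed
  have fin: "finite (pverts ?M)"
    using pair_finite_verts by (simp add: gen_mycielski_def)
  have "parcs ?M \<subseteq> pverts ?M \<times> pverts ?M"
    using E' by fastforce
  with fin have "finite (parcs ?M)"
    by (meson finite_SigmaI finite_subset)
  moreover have "symmetric ?M"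
    by (auto simp: symmetric_def gen_mycielski_def intro: symI)
  ultimately show ?thesis
    using E' fin by unfold_locales auto
qed

text \<open>
  The minimum defining \<^const>\<open>boxicity\<close> exists: use one coordinate for each vertex \<open>w\<close>, with
  \<open>[0, 0]\<close> for \<open>w\<close>, \<open>[0, 1]\<close> for its neighbours and \<open>[1, 1]\<close> for the other vertices.
\<close>

lemma box_representation_exists:
  assumes "pair_graph G"
  shows "\<exists>B. box_representation (card (pverts G)) G B"
proof -
  interpret pair_graph G by fact
  let ?n = "card (pverts G)"
  obtain f where f: "bij_betw f {..<?n} (pverts G)"
    using ex_bij_betw_nat_finite[OF pair_finite_verts] by (auto simp: atLeast0LessThan)
  have sym: "(v, u) \<in> parcs G" if "(u, v) \<in> parcs G" for u v
    using that pair_sym_arcs by (auto simp: symmetric_def elim: symE)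
  define a where "a v j = (if v = f j \<or> (v, f j) \<in> parcs G then 0 else 1 :: real)" for v j
  define b where "b v j = (if v = f j then 0 else 1 :: real)" for v j
  define B where "B v = (\<Pi>\<^sub>E j\<in>{..<?n}. {a v j..b v j})" for v
  have ab: "a v j \<le> b v j" for v j
    using pair_no_loops by (fastforce simp: a_def b_def)
  have box: "is_box ?n (B v)" for v
    unfolding is_box_def B_def using ab by blast
  have "(u, v) \<in> parcs G \<longleftrightarrow> B u \<inter> B v \<noteq> {}"
    if uv: "u \<in> pverts G" "v \<in> pverts G" "u \<noteq> v" for u v
  proof
    assume adj: "(u, v) \<in> parcs G"
    have "max (a u j) (a v j) \<le> min (b u j) (b v j)" for j
      using adj sym[OF adj] uv(3) by (auto simp: a_def b_def)
    then have "(\<lambda>j\<in>{..<?n}. max (a u j) (a v j)) \<in> B u \<inter> B v"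
      by (auto simp: B_def PiE_iff)
    then show "B u \<inter> B v \<noteq> {}" by blast
  next
    assume "B u \<inter> B v \<noteq> {}"
    then obtain x where x: "x \<in> B u" "x \<in> B v" by blast
    obtain j where j: "j < ?n" "f j = v"
      using f uv(2) by (force simp: bij_betw_def)
    have "a u j \<le> x j" "x j \<le> b v j"
      using x j(1) by (auto simp: B_def PiE_iff)
    then show "(u, v) \<in> parcs G"
      using j(2) uv(3) by (auto simp: a_def b_def split: if_splits)
  qed
  with box have "box_representation ?n G B"
    by (auto simp: box_representation_def)
  then show ?thesis by blast
qed

lemma boxicity_attained:
  assumes "pair_graph G"
  shows "\<exists>B. box_representation (boxicity G) G B"
  unfolding boxicity_def
  by (rule LeastI_ex) (use box_representation_exists[OF assms] in blast)

lemma boxicity_complete: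
  assumes "\<forall>u\<in>pverts G. \<forall>v\<in>pverts G. u \<noteq> v \<longrightarrow> (u, v) \<in> parcs G"
  shows "boxicity G = 0"
proof -
  have "box_representation 0 G (\<lambda>_. {\<lambda>_. undefined})"
    using assms by (auto simp: box_representation_def is_box_def)
  then have "boxicity G \<le> 0"
    unfolding boxicity_def by (intro Least_le) blast
  then show ?thesis by simp
qed

end

theory Submission
  imports Defs
begin

text \<open>
  The reason is that, for bipartite \<open>G\<close> with parts \<open>X\<close> and \<open>Y\<close>, the graph \<open>M\<^sub>r(G)\<close> without its apex
  unrolls into a path of independent sets: with \<open>X\<^sub>i\<close>, \<open>Y\<^sub>i\<close> the copies of the parts in layer \<open>i\<close>, all
  edges run between neighbours in the sequence
  \<open>\<dots>, Y\<^sub>3, X\<^sub>2, Y\<^sub>1, X\<^sub>1, Y\<^sub>2, X\<^sub>3, \<dots>\<close>, and between two neighbours of this sequence the edges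
  are exactly those of \<open>G\<close>. The two ends are the parts of layer \<open>r\<close>, and they are what the apex is
  joined to.

  Collapsing the layers below \<open>r\<close> to layer 1 and sending layer \<open>r\<close> to layer 2 is a homomorphism
  \<open>M\<^sub>r(G) \<rightarrow> M\<^sub>2(G)\<close>, so every box representation of \<open>M\<^sub>2(G)\<close> can be pulled back. The pulled-back boxes
  are disjoint for every non-edge at the apex, and for every pair of copies of vertices that are
  distinct and non-adjacent in \<open>G\<close>. The other non-edges join parts at distance at least 2 in the
  sequence, and a single further coordinate separates them: the part at position \<open>p\<close> gets the
  interval \<open>[p, p + 1]\<close>, the apex an interval that meets all of these. Hence even
  \<open>box(M\<^sub>r(G)) \<le> box(M\<^sub>2(G)) + 1\<close>; this is \<open>boxicity_gen_mycielski_le_Suc\<close>. The two ingredients are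
  the pull-back principle \<open>box_representation_pullback\<close> and the description
  \<open>copies_adjacent_iff_path_position\<close> of adjacency by positions.
\<close>

lemma box_Int_nonempty_iff:
  fixes a b a' b' :: "nat \<Rightarrow> real"
  shows "(\<Pi>\<^sub>E j\<in>{..<k}. {a j..b j}) \<inter> (\<Pi>\<^sub>E j\<in>{..<k}. {a' j..b' j}) \<noteq> {} \<longleftrightarrow>
    (\<forall>j<k. max (a j) (a' j) \<le> min (b j) (b' j))"
  by (auto simp: PiE_Int PiE_eq_empty_iff)

text \<open>
  Vertices with the same image receive the same box in the first \<open>k\<close> coordinates, which is why
  coincidence of images counts as adjacency here.
\<close>

lemma box_representation_pullback:
  fixes G :: "'a pair_pre_digraph" and H :: "'b pair_pre_digraph" and c d :: "'a \<Rightarrow> real"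
  assumes rep: "box_representation k H B"
    and h: "\<And>v. v \<in> pverts G \<Longrightarrow> h v \<in> pverts H"
    and cd: "\<And>v. v \<in> pverts G \<Longrightarrow> c v \<le> d v"
    and adj: "\<And>u v. \<lbrakk>u \<in> pverts G; v \<in> pverts G; u \<noteq> v\<rbrakk> \<Longrightarrow>
      (u, v) \<in> parcs G \<longleftrightarrow>
        (h u = h v \<or> (h u, h v) \<in> parcs H) \<and> max (c u) (c v) \<le> min (d u) (d v)"
  shows "\<exists>B'. box_representation (Suc k) G B'"
proof -
  have "\<forall>w\<in>pverts H. \<exists>a b. (\<forall>j<k. a j \<le> b j) \<and> B w = (\<Pi>\<^sub>E j\<in>{..<k}. {a j..b j})"
    using rep by (simp add: box_representation_def is_box_def)
  then obtain a b where ab: "\<And>w j. w \<in> pverts H \<Longrightarrow> j < k \<Longrightarrow> a w j \<le> b w j"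
    and B: "\<And>w. w \<in> pverts H \<Longrightarrow> B w = (\<Pi>\<^sub>E j\<in>{..<k}. {a w j..b w j})"
    by metis
  have adjH: "w = w' \<or> (w, w') \<in> parcs H \<longleftrightarrow>
      (\<forall>j<k. max (a w j) (a w' j) \<le> min (b w j) (b w' j))"
    if "w \<in> pverts H" "w' \<in> pverts H" for w w'
  proof (cases "w = w'")
    case True
    then show ?thesis using ab that by simp
  next
    case False
    then have "(w, w') \<in> parcs H \<longleftrightarrow> B w \<inter> B w' \<noteq> {}"
      using rep that by (simp add: box_representation_def)
    with False show ?thesis
      using B that box_Int_nonempty_iff by simp
  qed
  define a' where "a' v j = (if j < k then a (h v) j else c v)" for v j
  define b' where "b' v j = (if j < k then b (h v) j else d v)" for v j
  define B' where "B' v = (\<Pi>\<^sub>E j\<in>{..<Suc k}. {a' v j..b' v j})" for v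
  have "is_box (Suc k) (B' v)" if "v \<in> pverts G" for v
  proof -
    have "\<forall>j<Suc k. a' v j \<le> b' v j"
      using ab h cd that by (simp add: a'_def b'_def)
    then show ?thesis
      unfolding is_box_def B'_def by blast
  qed
  moreover have "(u, v) \<in> parcs G \<longleftrightarrow> B' u \<inter> B' v \<noteq> {}"
    if uv: "u \<in> pverts G" "v \<in> pverts G" "u \<noteq> v" for u v
  proof -
    have "B' u \<inter> B' v \<noteq> {} \<longleftrightarrow>
        (\<forall>j<Suc k. max (a' u j) (a' v j) \<le> min (b' u j) (b' v j))"
      unfolding B'_def by (rule box_Int_nonempty_iff)
    also have "\<dots> \<longleftrightarrow>
        (\<forall>j<k. max (a (h u) j) (a (h v) j) \<le> min (b (h u) j) (b (h v) j)) \<and>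
        max (c u) (c v) \<le> min (d u) (d v)"
      by (auto simp: a'_def b'_def less_Suc_eq)
    also have "\<dots> \<longleftrightarrow> (u, v) \<in> parcs G"
      using adj[OF uv] adjH[OF h[OF uv(1)] h[OF uv(2)]] by simp
    finally show ?thesis by simp
  qed
  ultimately have "box_representation (Suc k) G B'"
    by (simp add: box_representation_def)
  then show ?thesis by blast
qed

lemma Apex_in_gen_mycielski [simp]: "Apex \<in> pverts (gen_mycielski r G)"
  by (simp add: gen_mycielski_def)

lemma Copy_in_gen_mycielski_iff [simp]:
  "Copy i v \<in> pverts (gen_mycielski r G) \<longleftrightarrow> 1 \<le> i \<and> i \<le> r \<and> v \<in> pverts G"
  by (auto simp: gen_mycielski_def)

lemma Apex_Copy_arc_iff [simp]:
  "(Apex, Copy i v) \<in> parcs (gen_mycielski r G) \<longleftrightarrow> i = r \<and> v \<in> pverts G"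
  "(Copy i v, Apex) \<in> parcs (gen_mycielski r G) \<longleftrightarrow> i = r \<and> v \<in> pverts G"
  by (auto simp: gen_mycielski_def mycielski_edges_def)

lemma Copy_Copy_arc_iff:
  assumes "pair_graph G" and "1 \<le> i" "i \<le> r" "1 \<le> j" "j \<le> r"
  shows "(Copy i u, Copy j v) \<in> parcs (gen_mycielski r G) \<longleftrightarrow>
    (u, v) \<in> parcs G \<and> (i = 1 \<and> j = 1 \<or> j = i + 1 \<or> i = j + 1)"
proof -
  interpret pair_graph G by fact
  have sym: "(v, u) \<in> parcs G \<longleftrightarrow> (u, v) \<in> parcs G" for u v
    using pair_sym_arcs by (auto simp: symmetric_def elim: symE)
  have edge: "(Copy i u, Copy j v) \<in> mycielski_edges r G \<longleftrightarrow>
      (u, v) \<in> parcs G \<and> (i = 1 \<and> j = 1 \<or> j = i + 1)"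
    if "1 \<le> i" "j \<le> r" for i j u v
    using that by (auto simp: mycielski_edges_def)
  show ?thesis
    using assms(2-5) edge[of i j u v] edge[of j i v u] sym[of u v]
    by (auto simp: gen_mycielski_def)
qed

text \<open>
  Position of the copies of a part in the sequence
  \<open>\<dots>, Y\<^sub>3, X\<^sub>2, Y\<^sub>1, X\<^sub>1, Y\<^sub>2, X\<^sub>3, \<dots>\<close>, with \<open>X\<^sub>1\<close> at position 1 and \<open>Y\<^sub>1\<close> at position 0. The copies of \<open>X\<close>
  occupy the odd positions and the copies of \<open>Y\<close> the even ones.
\<close>

definition path_position :: "'a set \<Rightarrow> nat \<Rightarrow> 'a \<Rightarrow> int" where
  "path_position X i v = (if odd i \<longleftrightarrow> v \<in> X then int i else 1 - int i)"

lemma path_position_bounds: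
  assumes "1 \<le> i" "i \<le> r"
  shows "1 - int r \<le> path_position X i v" "path_position X i v \<le> int r"
  using assms by (auto simp: path_position_def)

lemma odd_path_position_iff: "odd (path_position X i v) \<longleftrightarrow> v \<in> X"
  by (auto simp: path_position_def)

text \<open>
  Positions have the parity of the part, so distinct positions within one part differ by at least 2.
\<close>

lemma path_position_close_same_part:
  assumes "u \<in> X \<longleftrightarrow> v \<in> X" and "1 \<le> i" "1 \<le> j"
  shows "\<bar>path_position X i u - path_position X j v\<bar> \<le> 1 \<longleftrightarrow> i = j"
proof
  assume close: "\<bar>path_position X i u - path_position X j v\<bar> \<le> 1"
  have "even (path_position X i u - path_position X j v)"
    using assms(1) odd_path_position_iff[of X i u] odd_path_position_iff[of X j v] by auto
  then obtain m where m: "path_position X i u - path_position X j v = 2 * m"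
    by (elim evenE)
  from close have "m = 0"
    unfolding m by presburger
  with m have "path_position X i u = path_position X j v"
    by simp
  then show "i = j"
    using assms by (simp add: path_position_def split: if_splits)
next
  assume "i = j"
  with assms(1) show "\<bar>path_position X i u - path_position X j v\<bar> \<le> 1"
    by (simp add: path_position_def)
qed

lemma path_position_close_other_part:
  assumes "u \<in> X \<longleftrightarrow> v \<notin> X" and "1 \<le> i" "1 \<le> j"
  shows "\<bar>path_position X i u - path_position X j v\<bar> \<le> 1 \<longleftrightarrow>
    i = 1 \<and> j = 1 \<or> j = i + 1 \<or> i = j + 1"
proof (cases "odd i \<longleftrightarrow> odd j")
  case True
  \<comment> \<open>Layers of equal parity put the two parts on opposite sides of the centre of the sequence.\<close>
  then have "\<bar>path_position X i u - path_position X j v\<bar> = int i + int j - 1"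
    using assms by (auto simp: path_position_def)
  moreover have "j \<noteq> i + 1" "i \<noteq> j + 1"
    using True by auto
  ultimately show ?thesis
    using assms(2,3) by linarith
next
  case False
  then have "\<bar>path_position X i u - path_position X j v\<bar> = \<bar>int i - int j\<bar>"
    using assms by (auto simp: path_position_def)
  moreover have "i \<noteq> j"
    using False by auto
  ultimately show ?thesis
    using False by auto
qed

text \<open>
  Equality of \<open>u\<close> and \<open>v\<close> may be admitted on the right because different copies of one vertex are
  never close. In this form the first conjunct survives the collapse of layers, and the second is
  what the further coordinate has to supply.
\<close>

lemma copies_adjacent_iff_path_position:
  assumes G: "pair_graph G"
    and parts: "pverts G = X \<union> Y" "X \<inter> Y = {}" "parcs G \<subseteq> X \<times> Y \<union> Y \<times> X"
    and i: "1 \<le> i" "i \<le> r" and j: "1 \<le> j" "j \<le> r"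
    and ne: "Copy i u \<noteq> Copy j v"
  shows "(Copy i u, Copy j v) \<in> parcs (gen_mycielski r G) \<longleftrightarrow>
    (u = v \<or> (u, v) \<in> parcs G) \<and> \<bar>path_position X i u - path_position X j v\<bar> \<le> 1"
proof (cases "(u, v) \<in> parcs G")
  case True
  then have "u \<in> X \<longleftrightarrow> v \<notin> X"
    using parts by auto
  with True show ?thesis
    using Copy_Copy_arc_iff[OF G i j] path_position_close_other_part[of u X v i j] i(1) j(1)
    by simp
next
  case False
  then have "(Copy i u, Copy j v) \<notin> parcs (gen_mycielski r G)"
    using Copy_Copy_arc_iff[OF G i j] by simp
  with False ne show ?thesis
    using path_position_close_same_part[of u X v i j] i j by auto
qed

text \<open>
  Layer \<open>r\<close> is kept apart from the layers below it, so that the image of the apex stays non-adjacent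
  to the latter.
\<close>

fun collapse_layers :: "nat \<Rightarrow> 'a mycielski_vertex \<Rightarrow> 'a mycielski_vertex" where
  "collapse_layers r Apex = Apex"
| "collapse_layers r (Copy i v) = Copy (if i < r then 1 else 2) v"

lemma boxicity_gen_mycielski_le_Suc:
  fixes G :: "'a pair_pre_digraph"
  assumes G: "pair_graph G" and "bipartite G" and r: "2 \<le> r"
  shows "boxicity (gen_mycielski r G) \<le> Suc (boxicity (gen_mycielski 2 G))"
proof -
  let ?M = "gen_mycielski r G" and ?N = "gen_mycielski 2 G" and ?h = "collapse_layers r"
  obtain X Y where parts: "pverts G = X \<union> Y" "X \<inter> Y = {}" "parcs G \<subseteq> X \<times> Y \<union> Y \<times> X"
    using assms(2) by (auto simp: bipartite_def)
  obtain B where B: "box_representation (boxicity ?N) ?N B"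
    using boxicity_attained[OF pair_graph_gen_mycielski[OF G]] by fastforce
  \<comment> \<open>The values at the apex are chosen to cover all intervals of copies.\<close>
  define c :: "'a mycielski_vertex \<Rightarrow> real" where
    "c w = (case w of Apex \<Rightarrow> of_int (1 - int r) | Copy i v \<Rightarrow> of_int (path_position X i v))" for w
  define d :: "'a mycielski_vertex \<Rightarrow> real" where
    "d w = (case w of Apex \<Rightarrow> of_int (int r + 1) | Copy i v \<Rightarrow> of_int (path_position X i v + 1))" for w
  have cd_Apex: "max (c Apex) (c (Copy i v)) \<le> min (d Apex) (d (Copy i v))"
    if "1 \<le> i" "i \<le> r" for i v
    using path_position_bounds[OF that, of X v] by (simp add: c_def d_def)
  have cd_Copy: "max (c (Copy i u)) (c (Copy j v)) \<le> min (d (Copy i u)) (d (Copy j v)) \<longleftrightarrow>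
      \<bar>path_position X i u - path_position X j v\<bar> \<le> 1" for i j u v
    by (simp add: c_def d_def) linarith
  have "\<exists>B'. box_representation (Suc (boxicity ?N)) ?M B'"
  proof (rule box_representation_pullback[OF B, where h = ?h and c = c and d = d])
    show "?h w \<in> pverts ?N" if "w \<in> pverts ?M" for w
      using that by (cases w) auto
    show "c w \<le> d w" for w
      by (cases w) (simp_all add: c_def d_def)
    show "(w, w') \<in> parcs ?M \<longleftrightarrow>
        (?h w = ?h w' \<or> (?h w, ?h w') \<in> parcs ?N) \<and> max (c w) (c w') \<le> min (d w) (d w')"
      if w: "w \<in> pverts ?M" "w' \<in> pverts ?M" "w \<noteq> w'" for w w'
    proof (cases w; cases w')
      fix i u j v
      assume eq: "w = Copy i u" "w' = Copy j v"
      have i: "1 \<le> i" "i \<le> r" and j: "1 \<le> j" "j \<le> r"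
        using w by (auto simp: eq)
      let ?close = "\<bar>path_position X i u - path_position X j v\<bar> \<le> 1"
      have M: "(w, w') \<in> parcs ?M \<longleftrightarrow> (u = v \<or> (u, v) \<in> parcs G) \<and> ?close"
        using copies_adjacent_iff_path_position[OF G parts i j] w(3) by (simp add: eq)
      have N: "(?h w, ?h w') \<in> parcs ?N \<longleftrightarrow> (u, v) \<in> parcs G \<and> (i < r \<or> j < r)"
        using Copy_Copy_arc_iff[OF G, of "if i < r then 1 else 2" 2 "if j < r then 1 else 2" u v]
        by (auto simp: eq)
      \<comment> \<open>The two parts of layer \<open>r\<close> are the ends of the path, hence far apart because \<open>r \<ge> 2\<close>.\<close>
      have ends: "i < r \<or> j < r" if "(u, v) \<in> parcs G" ?close
      proof -
        have "u \<in> X \<longleftrightarrow> v \<notin> X"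
          using that(1) parts by auto
        then have "i = 1 \<and> j = 1 \<or> j = i + 1 \<or> i = j + 1"
          using path_position_close_other_part[of u X v i j] that(2) i(1) j(1) by simp
        then show ?thesis
          using i j r by linarith
      qed
      have same: "?h w \<noteq> ?h w'" if "u \<noteq> v"
        using that by (simp add: eq)
      have diff: "\<not> ?close" if "u = v"
        using path_position_close_same_part[of u X v i j] that w(3) i j by (simp add: eq)
      have overlap: "max (c w) (c w') \<le> min (d w) (d w') \<longleftrightarrow> ?close"
        unfolding eq by (rule cd_Copy)
      show ?thesis
        using M N ends same diff overlap by metis
    next
      fix j v
      assume eq: "w = Apex" "w' = Copy j v"
      show ?thesis
        using w cd_Apex[of j v] by (auto simp: eq)
    next
      fix i u
      assume eq: "w = Copy i u" "w' = Apex"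
      show ?thesis
        using w cd_Apex[of i u] by (auto simp: eq max.commute min.commute)
    qed (use w in simp)
  qed
  then show ?thesis
    unfolding boxicity_def[of ?M] by (rule Least_le)
qed

theorem theorem5p1:
  fixes G :: "'a pair_pre_digraph" and r :: nat
  assumes "pair_graph G" and "bipartite G" and "2 \<le> r"
  shows "boxicity (gen_mycielski r G) \<le> boxicity (gen_mycielski 2 G) + 2"
  using boxicity_gen_mycielski_le_Suc[OF assms] by simp

end
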